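(* Let $n\ge 2$ be an integer (even or odd). The polytope $Q_n\subset\mathbb{R}^{n^2}$ has dimension $2n-2$ and is (up to affine isomorphism) a free sum $\Delta_{n-1}\oplus\Delta_{n-1}$ of two copies of an $(n-1)$-dimensional simplex $\Delta_{n-1}$. Taking coordinates $x_0,\ldots,x_{n^2-1}$ on $\mathbb{R}^{n^2}$, the affine hull of $Q_n$ is given by the equations $$1=\sum_{i=ln}^{(l+1)n-1}x_i \qquad (0\le l\le n-1),$$ $$0=x_{kn+[j]_n}-x_{(k+1)n+[j]_n}-x_{(k+1)n+[j+1]_n}+x_{(k+2)n+[j+1]_n}\qquad (0\le j\le n-2,\ 0\le k\le n-3).$$ An irredundant system of inequalities defining $Q_n$ inside its affine hull is given by the inequalities $$x_i\ge 0\qquad (0\le i\le n^2-1).$$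
   Context: For integers $s$ and $k$ with $k\geq 1$, $[s]_k\in\{0,\ldots,k-1\}$ denotes the remainder of $s$ upon division by $k$. Let $I$ be the $n\times n$ identity matrix and let $R$ be the $n\times n$ matrix, with rows and columns indexed by $0,\ldots,n-1$, whose entry at $(i,j)$ is $1$ if $j\equiv i+1 \bmod n$ and $0$ otherwise. The polytope $Q_n\subset\mathbb{R}^{n^2}$ is the convex hull of the rows of the $2n\times n^2$ block matrix $$W=\begin{bmatrix} I & I & I & \cdots & I\\ I & R^1 & R^2 & \cdots & R^{n-1}\end{bmatrix}$$ with $n$ blocks in each of the two block rows. The columns of $W$ are indexed in order by $0,\ldots,n^2-1$, so that the coordinate $x_{kn+j}$ ($0\le k,j\le n-1$) corresponds to column $j$ of the $k$-th block column. The free sum of polytopes $P\subset\mathbb{R}^{d}$ and $P'\subset\mathbb{R}^{d'}$ of dimensions $d$ and $d'$ is $$P\oplus P'=\operatorname{conv}\left(\{(p,0)\in\mathbb{R}^{d+d'} : p\in P\}\cup\{(0,p')\in\mathbb{R}^{d+d'} : p'\in P'\}\right),$$ where $P$ and $P'$ are positioned so that the origin lies in their interiors; thus the free sum assertion says that there is an $(n-1)$-dimensional simplex $\Delta\subset\mathbb{R}^{n-1}$ with the origin in its interior such that $Q_n$ is affinely isomorphic to $\Delta\oplus\Delta$. *)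

theory Defs
  imports "HOL-Analysis.Analysis" "HOL-Number_Theory.Cong" "Jordan_Normal_Form.Matrix"
begin

(* Both matrix libraries use the same infix for vector components; here it is reserved for
   the Analysis type of vectors. *)
no_notation vec_index (infixl "$" 100)

definition shift_mat :: "nat \<Rightarrow> real mat" where
  "shift_mat n = mat n n (\<lambda>(i, j). if [j = i + 1] (mod n) then 1 else 0)"

(* The column index c = k * n + j lies in block column k = c div n at position j = c mod n.
   The first block of the lower block row is the identity, i.e. the zeroth power. *)
definition W_mat :: "nat \<Rightarrow> real mat" where
  "W_mat n = mat (2 * n) (n\<^sup>2)
     (\<lambda>(r, c). if r < n then 1\<^sub>m n $$ (r, c mod n)
              else (shift_mat n ^\<^sub>m (c div n)) $$ (r - n, c mod n))"

(* The space of dimension n^2 is real ^ 'm, where idx enumerates the index type 'm by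
   {..<n^2}; the i-th coordinate of x is x $ idx i. *)
definition Q_poly :: "nat \<Rightarrow> (nat \<Rightarrow> 'm::finite) \<Rightarrow> (real ^ 'm) set" where
  "Q_poly n idx = convex hull
     ((\<lambda>r. \<chi> a. W_mat n $$ (r, inv_into {..<n\<^sup>2} idx a)) ` {..<2 * n})"

(* Only meant for full-dimensional P and P' with the origin in their interiors. *)
definition free_sum ::
    "'a::real_vector set \<Rightarrow> 'b::real_vector set \<Rightarrow> ('a \<times> 'b) set" where
  "free_sum P P' = convex hull ((\<lambda>p. (p, 0)) ` P \<union> (\<lambda>p'. (0, p')) ` P')"

(* The affine map of the ambient spaces has to be bijective between P and P' only, since the
   ambient dimensions may differ. *)
definition affinely_isomorphic ::
    "'a::real_vector set \<Rightarrow> 'b::real_vector set \<Rightarrow> bool" where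
  "affinely_isomorphic P P' \<longleftrightarrow> (\<exists>h c. linear h \<and> bij_betw (\<lambda>x. h x + c) P P')"

(* The inequalities f i x >= 0 for i in I define P inside A, and none of them can be
   omitted. *)
definition irredundant_system ::
    "'i set \<Rightarrow> ('i \<Rightarrow> 'a \<Rightarrow> real) \<Rightarrow> 'a set \<Rightarrow> 'a set \<Rightarrow> bool" where
  "irredundant_system I f A P \<longleftrightarrow>
     P = {x \<in> A. \<forall>i\<in>I. f i x \<ge> 0} \<and>
     (\<forall>i\<in>I. P \<noteq> {x \<in> A. \<forall>i'\<in>I - {i}. f i' x \<ge> 0})"

end

theory Submission imports Defs begin

text \<open>
  Read a vector of length \<open>n\<^sup>2\<close> as an \<open>n \<times> n\<close> array \<open>x k j\<close> (block \<open>k\<close>, position \<open>j\<close>). Since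
  \<open>R\<^sup>k\<close> shifts by \<open>k\<close>, the upper row \<open>r\<close> of \<open>W\<close> is the indicator of the column \<open>j = r\<close> and the lower
  row \<open>s\<close> is the indicator of the cyclic diagonal \<open>j - k = s\<close>. So combinations of rows are the arrays
  \<open>x k j = u j + v (j - k)\<close>, with the weights \<open>u\<close> on the columns and \<open>v\<close> on the diagonals. Everything
  follows from this parametrization (\<open>grid_vec\<close> below) and from one fact: a column and a diagonal meet
  in exactly one cell (\<open>bij_betw_column_diagonal\<close>), so the coordinates are all the sums
  \<open>u j + v i\<close>, each occurring once.

  \<^item> The affine hull consists of the arrays with \<open>\<Sum>u + \<Sum>v = 1\<close>, because the barycentre of the rows has
    positive weights, and the polytope of those that admit such weights with \<open>u, v \<ge> 0\<close>. The weights are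
    determined only up to moving a constant from \<open>v\<close> to \<open>u\<close>; moving \<open>min v\<close> makes all weights
    nonnegative as soon as all \<open>u j + v i\<close> are (\<open>Q_poly_eq_nonneg\<close>). On the other
    hand, the weights \<open>-s\<close> on one column, \<open>0\<close> on one diagonal and \<open>s > 0\<close> on all others violate exactly
    the inequality of the cell where the two meet
    (\<open>coordinate_irredundant\<close>).

  \<^item> The equations say that \<open>d k j = x k j - x (k + 1) j\<close> is constant along diagonals. The
    equation at \<open>j = n - 1\<close>, which is not listed, follows from the equal block sums. Hence
    \<open>d k j = a (j - k)\<close> with \<open>\<Sum>a = 0\<close>, so that \<open>a\<close> is the cyclic difference of its partial sums
    \<open>V\<close>, and summing over \<open>k\<close> gives \<open>x k j = (x 0 j - V j) + V (j - k)\<close>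
    (\<open>equations_imp_point\<close>).

  \<^item> Subtracting the barycentre leaves the arrays with \<open>\<Sum>u = \<Sum>v = 0\<close>, and under this
    normalization the weights are unique. Such a \<open>u\<close> is given by its first \<open>n - 1\<close> entries, so the affine hull
    is a translate of the image of \<open>\<real>\<^sup>n\<^sup>-\<^sup>1 \<times> \<real>\<^sup>n\<^sup>-\<^sup>1\<close> under an injective linear map. This gives the
    dimension. The map takes \<open>(b r, 0)\<close> and \<open>(0, b r)\<close> to the two kinds of rows, where the
    \<open>b r\<close> are the vertices of the standard simplex moved so that their sum is \<open>0\<close>; so it
    takes the free sum of two copies of this simplex onto the polytope
    (\<open>Q_poly_eq_lift_free_sum\<close>).
\<close>

section \<open>Columns and cyclic diagonals of the square grid\<close>

lemma shift_mat_power_index: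
  assumes "s < n" "j < n"
  shows "(shift_mat n ^\<^sub>m k) $$ (s, j) = (if [j = s + k] (mod n) then 1 else 0)"
  using assms
proof (induction k arbitrary: j)
  case 0
  then show ?case by (auto simp: shift_mat_def cong_def)
next
  case (Suc k)
  have dims: "shift_mat n \<in> carrier_mat n n" "shift_mat n ^\<^sub>m k \<in> carrier_mat n n"
    by (simp_all add: shift_mat_def pow_carrier_mat)
  let ?t = "(s + k) mod n"
  have t: "?t < n" using Suc.prems by simp
  have "(shift_mat n ^\<^sub>m Suc k) $$ (s, j)
      = (\<Sum>t<n. (shift_mat n ^\<^sub>m k) $$ (s, t) * shift_mat n $$ (t, j))"
    using Suc.prems dims by (auto simp: scalar_prod_def lessThan_atLeast0)
  also have "\<dots> = (\<Sum>t<n. if t = ?t then shift_mat n $$ (t, j) else 0)"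
    using Suc by (intro sum.cong) (auto simp: cong_def)
  also have "\<dots> = shift_mat n $$ (?t, j)"
    using t by simp
  also have "\<dots> = (if [j = s + Suc k] (mod n) then 1 else 0)"
    using t Suc.prems by (simp add: shift_mat_def cong_def mod_Suc_eq)
  finally show ?case .
qed

text \<open>The number \<open>j - k\<close> modulo \<open>n\<close> of the cyclic diagonal through the cell in block \<open>k\<close> at position \<open>j\<close>;
  adding \<open>n\<close> first keeps the subtraction on natural numbers exact, as \<open>k < n\<close>.\<close>

definition diagonal :: "nat \<Rightarrow> nat \<Rightarrow> nat" where
  "diagonal n c = (c mod n + n - c div n) mod n"

definition grid_vec ::
    "nat \<Rightarrow> (nat \<Rightarrow> 'm::finite) \<Rightarrow> (nat \<Rightarrow> real) \<Rightarrow> (nat \<Rightarrow> real) \<Rightarrow> real ^ 'm" where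
  "grid_vec n idx u v =
     (\<chi> a. let c = inv_into {..<n\<^sup>2} idx a in u (c mod n) + v (diagonal n c))"

lemma diagonal_less: "0 < n \<Longrightarrow> diagonal n c < n"
  by (simp add: diagonal_def)

text \<open>The congruence on the right is the condition for a \<open>1\<close> in row \<open>s\<close> of the power of the shift matrix
  with exponent \<open>c div n\<close>, which is how lower rows of \<open>W\<close> become indicators of diagonals.\<close>

lemma diagonal_eq_iff:
  assumes "s < n" "c < n\<^sup>2"
  shows "diagonal n c = s \<longleftrightarrow> [c mod n = s + c div n] (mod n)"
proof -
  have k: "c div n < n" using assms by (simp add: power2_eq_square less_mult_imp_div_less)
  have "diagonal n c = s \<longleftrightarrow> [c mod n + n - c div n = s] (mod n)"
    using assms by (simp add: diagonal_def cong_def)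
  also have "\<dots> \<longleftrightarrow> [c mod n + n - c div n + c div n = s + c div n] (mod n)"
    by (simp only: cong_add_rcancel_nat)
  also have "\<dots> \<longleftrightarrow> [c mod n = s + c div n] (mod n)"
    using k by (simp add: cong_def)
  finally show ?thesis .
qed

text \<open>Column \<open>j\<close> and diagonal \<open>i\<close> meet only in block \<open>j - i\<close>. This gives injectivity, and there are as
  many cells as pairs.\<close>

lemma bij_betw_column_diagonal:
  assumes "0 < n"
  shows "bij_betw (\<lambda>c. (c mod n, diagonal n c)) {..<n\<^sup>2} ({..<n} \<times> {..<n})"
proof -
  let ?F = "\<lambda>c. (c mod n, diagonal n c)"
  have "inj_on ?F {..<n\<^sup>2}"
  proof (rule inj_onI)
    fix c d assume *: "c \<in> {..<n\<^sup>2}" "d \<in> {..<n\<^sup>2}" "?F c = ?F d"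
    then have "[diagonal n c + c div n = diagonal n c + d div n] (mod n)"
      using diagonal_eq_iff[of "diagonal n c" n c] diagonal_eq_iff[of "diagonal n c" n d]
        diagonal_less[OF assms]
      by (auto simp: cong_def)
    then have "[c div n = d div n] (mod n)"
      by (simp only: cong_add_lcancel_nat)
    moreover have "c div n < n" "d div n < n"
      using * by (simp_all add: power2_eq_square less_mult_imp_div_less)
    ultimately have "c div n = d div n" by (simp add: cong_def)
    moreover have "c mod n = d mod n" using * by simp
    ultimately show "c = d" by (metis div_mult_mod_eq)
  qed
  moreover have "?F ` {..<n\<^sup>2} \<subseteq> {..<n} \<times> {..<n}"
    using assms by (auto simp: diagonal_less)
  ultimately show ?thesis
    unfolding bij_betw_def by (simp add: card_subset_eq card_image power2_eq_square)
qed

text \<open>A cyclic rotation permutes the indices; in particular, each diagonal occurs exactly once in a block.\<close>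

lemma sum_mod_shift:
  fixes v :: "nat \<Rightarrow> 'a::ab_group_add"
  shows "(\<Sum>j<n. v ((j + m) mod n)) = (\<Sum>j<n. v j)"
proof (induction m)
  case (Suc m)
  have "v (m mod n) + (\<Sum>j<n. v ((j + Suc m) mod n)) = (\<Sum>j<Suc n. v ((j + m) mod n))"
    by (subst sum.lessThan_Suc_shift) simp
  also have "\<dots> = v (m mod n) + (\<Sum>j<n. v ((j + m) mod n))"
    by simp
  finally show ?case using Suc by simp
qed simp

lemma sum_block:
  fixes n :: nat
  assumes "0 < n"
  shows "(\<Sum>i = l * n..(l + 1) * n - 1. g i) = (\<Sum>j<n. g (l * n + j))"
proof -
  have "{l * n..(l + 1) * n - 1} = {0 + l * n..<n + l * n}"
    using assms by auto
  then show ?thesis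
    unfolding lessThan_atLeast0 by (simp only: sum.shift_bounds_nat_ivl add.commute)
qed

lemma sum_lessThan_add:
  fixes g :: "nat \<Rightarrow> 'a::ab_group_add"
  shows "(\<Sum>r<n + m. g r) = (\<Sum>r<n. g r) + (\<Sum>r<m. g (n + r))"
  by (induction m) (simp_all add: add.assoc)

section \<open>The polytope and its affine hull in terms of weights\<close>

locale enumerated_grid =
  fixes n :: nat and idx :: "nat \<Rightarrow> 'm::finite"
  assumes two_le_n: "n \<ge> 2"
    and idx: "bij_betw idx {..<n\<^sup>2} UNIV"
begin

abbreviation point :: "(nat \<Rightarrow> real) \<Rightarrow> (nat \<Rightarrow> real) \<Rightarrow> real ^ 'm" where
  "point \<equiv> grid_vec n idx"

abbreviation total :: "(nat \<Rightarrow> real) \<Rightarrow> real" where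
  "total u \<equiv> (\<Sum>i<n. u i)"

lemma n_pos: "0 < n" using two_le_n by simp

lemma point_nth:
  "c < n\<^sup>2 \<Longrightarrow> point u v $ idx c = u (c mod n) + v (diagonal n c)"
  using idx by (simp add: grid_vec_def bij_betw_def inv_into_f_f)

lemma vec_eq_on_grid:
  assumes "\<And>c. c < n\<^sup>2 \<Longrightarrow> x $ idx c = y $ idx c"
  shows "x = (y :: real ^ 'm)"
proof -
  have "x $ a = y $ a" for a
    using assms idx by (metis UNIV_I bij_betw_def imageE lessThan_iff)
  then show ?thesis by (simp add: Finite_Cartesian_Product.vec_eq_iff)
qed

lemma cell_less: "k < n \<Longrightarrow> j < n \<Longrightarrow> k * n + j < n\<^sup>2"
proof -
  assume "k < n" "j < n"
  then have "k * n + j < (k + 1) * n" by simp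
  also have "\<dots> \<le> n * n" using \<open>k < n\<close> by (intro mult_le_mono1) simp
  finally show ?thesis by (simp add: power2_eq_square)
qed

lemma point_cell:
  assumes "k < n" "j < n"
  shows "point u v $ idx (k * n + j) = u j + v ((j + n - k) mod n)"
  using assms cell_less[OF assms] by (simp add: point_nth diagonal_def)

lemma column_diagonal_cell:
  assumes "j < n" "i < n"
  obtains c where "c < n\<^sup>2" "c mod n = j" "diagonal n c = i"
proof -
  have "(j, i) \<in> (\<lambda>c. (c mod n, diagonal n c)) ` {..<n\<^sup>2}"
    using bij_betw_column_diagonal[OF n_pos] assms by (auto simp: bij_betw_def)
  then show ?thesis using that by auto
qed

lemma point_add: "point u v + point u' v' = point (\<lambda>i. u i + u' i) (\<lambda>i. v i + v' i)"
  by (simp add: grid_vec_def Finite_Cartesian_Product.vec_eq_iff Let_def)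

lemma point_scale: "t *\<^sub>R point u v = point (\<lambda>i. t * u i) (\<lambda>i. t * v i)"
  by (simp add: grid_vec_def Finite_Cartesian_Product.vec_eq_iff Let_def algebra_simps)

lemma point_cong:
  assumes "\<And>i. i < n \<Longrightarrow> u i = u' i" "\<And>i. i < n \<Longrightarrow> v i = v' i"
  shows "point u v = point u' v'"
  using assms n_pos by (simp add: grid_vec_def Finite_Cartesian_Product.vec_eq_iff Let_def diagonal_less)

text \<open>The only ambiguity of the weights: every cell lies in one column and on one diagonal, so a
  constant can be moved from one family to the other.\<close>

lemma point_shift: "point (\<lambda>i. u i + s) v = point u (\<lambda>i. v i + s)"
  by (simp add: grid_vec_def Finite_Cartesian_Product.vec_eq_iff Let_def)

definition row :: "nat \<Rightarrow> real ^ 'm" where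
  "row r = (\<chi> a. W_mat n $$ (r, inv_into {..<n\<^sup>2} idx a))"

lemma row_nth: "c < n\<^sup>2 \<Longrightarrow> row r $ idx c = W_mat n $$ (r, c)"
  using idx by (simp add: row_def bij_betw_def inv_into_f_f)

lemma row_upper:
  assumes "r < n"
  shows "row r = point (\<lambda>i. if i = r then 1 else 0) (\<lambda>_. 0)"
  using assms n_pos by (intro vec_eq_on_grid) (auto simp: row_nth point_nth W_mat_def)

lemma row_lower:
  assumes "s < n"
  shows "row (n + s) = point (\<lambda>_. 0) (\<lambda>i. if i = s then 1 else 0)"
proof (rule vec_eq_on_grid)
  fix c assume "c < n\<^sup>2"
  then show "row (n + s) $ idx c = point (\<lambda>_. 0) (\<lambda>i. if i = s then 1 else 0) $ idx c"
    using assms n_pos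
    by (simp add: row_nth point_nth W_mat_def shift_mat_power_index diagonal_eq_iff)
qed

lemma Q_poly_eq_hull_rows: "Q_poly n idx = convex hull (row ` {..<2 * n})"
  by (simp add: Q_poly_def row_def)

lemma row_cases:
  assumes "r < 2 * n"
  obtains (upper) "r < n" | (lower) s where "s < n" "r = n + s"
proof (cases "r < n")
  case False
  then have "r - n < n" "r = n + (r - n)" using assms by simp_all
  then show ?thesis by (rule lower)
qed (rule upper)

lemma point_eq_sum_rows:
  "point u v = (\<Sum>r<n. u r *\<^sub>R row r) + (\<Sum>r<n. v r *\<^sub>R row (n + r))"
proof (rule vec_eq_on_grid)
  fix c assume c: "c < n\<^sup>2"
  have "(\<Sum>r<n. u r * (row r $ idx c)) = (\<Sum>r<n. if r = c mod n then u r else 0)"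
    using c by (intro sum.cong) (auto simp: row_upper point_nth)
  moreover have "(\<Sum>r<n. v r * (row (n + r) $ idx c)) = (\<Sum>r<n. if r = diagonal n c then v r else 0)"
    using c by (intro sum.cong) (auto simp: row_lower point_nth)
  ultimately show "point u v $ idx c
      = ((\<Sum>r<n. u r *\<^sub>R row r) + (\<Sum>r<n. v r *\<^sub>R row (n + r))) $ idx c"
    using c n_pos by (simp add: point_nth diagonal_less)
qed

lemma point_in_Q_poly:
  assumes "\<And>i. i < n \<Longrightarrow> 0 \<le> u i" "\<And>i. i < n \<Longrightarrow> 0 \<le> v i" "total u + total v = 1"
  shows "point u v \<in> Q_poly n idx"
proof -
  let ?w = "\<lambda>r. if r < n then u r else v (r - n)"
  have "point u v = (\<Sum>r<2 * n. ?w r *\<^sub>R row r)"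
    by (simp add: mult_2 sum_lessThan_add point_eq_sum_rows)
  also have "\<dots> \<in> Q_poly n idx"
    unfolding Q_poly_eq_hull_rows
  proof (rule convex_sum)
    show "(\<Sum>r<2 * n. ?w r) = 1"
      using assms(3) by (simp add: mult_2 sum_lessThan_add)
    show "0 \<le> ?w r" if "r \<in> {..<2 * n}" for r
      using that assms(1,2) by simp
    show "row r \<in> convex hull (row ` {..<2 * n})" if "r \<in> {..<2 * n}" for r
      using that by (intro hull_inc imageI)
  qed simp_all
  finally show ?thesis .
qed

lemma Q_poly_eq:
  "Q_poly n idx = {point u v | u v.
     (\<forall>i<n. 0 \<le> u i) \<and> (\<forall>i<n. 0 \<le> v i) \<and> total u + total v = 1}" (is "_ = ?C")
proof
  show "Q_poly n idx \<subseteq> ?C"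
    unfolding Q_poly_eq_hull_rows
  proof (rule hull_minimal)
    show "row ` {..<2 * n} \<subseteq> ?C"
    proof clarify
      fix r assume "r < 2 * n"
      then show "\<exists>u v. row r = point u v \<and> (\<forall>i<n. 0 \<le> u i) \<and> (\<forall>i<n. 0 \<le> v i)
        \<and> total u + total v = 1"
      proof (cases rule: row_cases)
        case upper
        then show ?thesis
          by (intro exI[of _ "\<lambda>i. if i = r then 1 else 0"] exI[of _ "\<lambda>_. 0"]) (simp add: row_upper)
      next
        case (lower s)
        then show ?thesis
          by (intro exI[of _ "\<lambda>_. 0"] exI[of _ "\<lambda>i. if i = s then 1 else 0"]) (simp add: row_lower)
      qed
    qed
    show "convex ?C"
    proof (rule convexI)
      fix x y and s t :: real
      assume st: "0 \<le> s" "0 \<le> t" "s + t = 1" and "x \<in> ?C" "y \<in> ?C"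
      then obtain u v u' v' where
        x: "x = point u v" "\<forall>i<n. 0 \<le> u i" "\<forall>i<n. 0 \<le> v i" "total u + total v = 1" and
        y: "y = point u' v'" "\<forall>i<n. 0 \<le> u' i" "\<forall>i<n. 0 \<le> v' i" "total u' + total v' = 1"
        by blast
      have "total (\<lambda>i. s * u i + t * u' i) + total (\<lambda>i. s * v i + t * v' i)
          = s * (total u + total v) + t * (total u' + total v')"
        by (simp add: sum.distrib sum_distrib_left algebra_simps)
      also have "\<dots> = 1"
        using st x y by simp
      finally have sum_one:
        "total (\<lambda>i. s * u i + t * u' i) + total (\<lambda>i. s * v i + t * v' i) = 1" .
      have eq: "s *\<^sub>R x + t *\<^sub>R y
          = point (\<lambda>i. s * u i + t * u' i) (\<lambda>i. s * v i + t * v' i)"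
        by (simp add: x y point_scale point_add)
      have nonneg: "\<forall>i<n. 0 \<le> s * u i + t * u' i" "\<forall>i<n. 0 \<le> s * v i + t * v' i"
        using st x y by simp_all
      show "s *\<^sub>R x + t *\<^sub>R y \<in> ?C"
        by (intro CollectI exI conjI) (rule eq sum_one nonneg)+
    qed
  qed
  show "?C \<subseteq> Q_poly n idx"
    using point_in_Q_poly by blast
qed

text \<open>An affine combination of the rows lies on a line through the barycentre of the rows and a point of
  the polytope, because mixing in enough of the barycentre makes all weights nonnegative.\<close>

lemma affine_hull_Q_poly:
  "affine hull (Q_poly n idx) = {point u v | u v. total u + total v = 1}" (is "_ = ?A")
proof
  show "affine hull (Q_poly n idx) \<subseteq> ?A"
  proof (rule hull_minimal)
    show "Q_poly n idx \<subseteq> ?A" unfolding Q_poly_eq by blast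
    show "affine ?A"
      unfolding affine_def
    proof clarify
      fix s t :: real and u v u' v'
      assume "s + t = 1" "total u + total v = 1" "total u' + total v' = 1"
      then have "s * (total u + total v) + t * (total u' + total v') = 1" by simp
      then show "\<exists>u'' v''. s *\<^sub>R point u v + t *\<^sub>R point u' v' = point u'' v''
          \<and> total u'' + total v'' = 1"
        by (intro exI[of _ "\<lambda>i. s * u i + t * u' i"] exI[of _ "\<lambda>i. s * v i + t * v' i"])
          (simp add: point_scale point_add sum.distrib sum_distrib_left algebra_simps)
    qed
  qed
  show "?A \<subseteq> affine hull (Q_poly n idx)"
  proof clarify
    fix u v assume uv: "total u + total v = 1"
    \<comment> \<open>\<open>M\<close> makes all weights nonnegative, and \<open>N\<close> is the total of the weights after adding \<open>M\<close>.\<close>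
    define M where "M = 1 + (\<Sum>i<n. \<bar>u i\<bar>) + (\<Sum>i<n. \<bar>v i\<bar>)"
    have abs_sum: "\<bar>w i\<bar> \<le> (\<Sum>i<n. \<bar>w i\<bar>)" if "i < n" for w :: "nat \<Rightarrow> real" and i
      using that by (intro member_le_sum) auto
    have pos: "0 \<le> (\<Sum>i<n. \<bar>w i\<bar>)" for w :: "nat \<Rightarrow> real" by (simp add: sum_nonneg)
    have M: "1 \<le> M" "\<And>i. i < n \<Longrightarrow> 0 \<le> u i + M" "\<And>i. i < n \<Longrightarrow> 0 \<le> v i + M"
      using pos[of u] pos[of v] abs_sum[of _ u] abs_sum[of _ v] unfolding M_def
      by (force simp: abs_le_iff)+
    define N where "N = 1 + 2 * real n * M"
    have N: "1 < N" using M(1) n_pos by (simp add: N_def)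
    let ?y = "point (\<lambda>i. (u i + M) / N) (\<lambda>i. (v i + M) / N)"
    let ?b = "point (\<lambda>i. 1 / (2 * real n)) (\<lambda>i. 1 / (2 * real n))"
    have "total (\<lambda>i. (u i + M) / N) + total (\<lambda>i. (v i + M) / N) = (total u + total v + 2 * real n * M) / N"
      by (simp add: sum_divide_distrib[symmetric] sum.distrib add_divide_distrib)
    also have "\<dots> = 1" using N uv by (simp add: N_def[symmetric])
    finally have "?y \<in> Q_poly n idx"
      using M N by (intro point_in_Q_poly) auto
    moreover have "?b \<in> Q_poly n idx"
      using n_pos by (intro point_in_Q_poly) auto
    ultimately have "N *\<^sub>R ?y + (1 - N) *\<^sub>R ?b \<in> affine hull (Q_poly n idx)"
      by (intro mem_affine affine_affine_hull hull_inc) auto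
    moreover have "N *\<^sub>R ?y + (1 - N) *\<^sub>R ?b = point u v"
      using N n_pos by (simp add: point_scale point_add) (simp add: N_def field_simps)
    ultimately show "point u v \<in> affine hull (Q_poly n idx)" by simp
  qed
qed

text \<open>The weights of a nonnegative point may be negative, but every sum \<open>u j + v i\<close> is a coordinate. So
  moving the minimum of \<open>v\<close> over to \<open>u\<close> makes \<open>v\<close> nonnegative and, at the diagonal that attains
  the minimum, shows that \<open>u\<close> is nonnegative as well.\<close>

lemma Q_poly_eq_nonneg:
  "Q_poly n idx = {x \<in> affine hull (Q_poly n idx). \<forall>i\<in>{0..n\<^sup>2 - 1}. 0 \<le> x $ idx i}"
  (is "_ = ?N")
proof
  show "Q_poly n idx \<subseteq> ?N"
  proof
    fix x assume x: "x \<in> Q_poly n idx"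
    then have "x \<in> affine hull (Q_poly n idx)" by (rule hull_inc)
    moreover have "0 \<le> x $ idx i" if "i \<in> {0..n\<^sup>2 - 1}" for i
    proof -
      have "i < n\<^sup>2" using that n_pos by (simp add: Suc_le_eq[symmetric] le_diff_conv2)
      then show ?thesis using x n_pos by (auto simp: Q_poly_eq point_nth diagonal_less)
    qed
    ultimately show "x \<in> ?N" by blast
  qed
  show "?N \<subseteq> Q_poly n idx"
  proof
    fix x assume x: "x \<in> ?N"
    then obtain u v where uv: "x = point u v" "total u + total v = 1"
      by (auto simp: affine_hull_Q_poly)
    define m where "m = Min (v ` {..<n})"
    have m: "m \<le> v i" if "i < n" for i using that by (simp add: m_def)
    obtain i0 where i0: "i0 < n" "v i0 = m"
      using Min_in[of "v ` {..<n}"] n_pos unfolding m_def by fastforce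
    have u: "0 \<le> u j + m" if j: "j < n" for j
    proof -
      obtain c where c: "c < n\<^sup>2" "c mod n = j" "diagonal n c = i0"
        using column_diagonal_cell[OF j i0(1)] .
      then have "0 \<le> x $ idx c" using x by auto
      then show ?thesis using c i0 uv by (simp add: point_nth)
    qed
    have "x = point (\<lambda>i. u i + m) (\<lambda>i. v i - m)"
      by (simp add: point_shift uv)
    also have "\<dots> \<in> Q_poly n idx"
      using u m uv by (intro point_in_Q_poly) (auto simp: sum.distrib sum_subtractf)
    finally show "x \<in> Q_poly n idx" .
  qed
qed

text \<open>Give the column of the cell weight \<open>-s\<close>, its diagonal weight \<open>0\<close>, and all other columns and diagonals
  weight \<open>s\<close>. A cell outside that column has no negative weight, and in the column the weight \<open>s\<close> of
  every other diagonal makes up for the \<open>-s\<close>.\<close>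

lemma coordinate_irredundant:
  assumes "c < n\<^sup>2"
  obtains x where "x \<in> affine hull (Q_poly n idx)" "x $ idx c < 0"
    "\<And>c'. c' < n\<^sup>2 \<Longrightarrow> c' \<noteq> c \<Longrightarrow> 0 \<le> x $ idx c'"
proof -
  \<comment> \<open>The total weight is \<open>-s + (n - 1) s + (n - 1) s\<close>.\<close>
  define s where "s = 1 / (2 * real n - 3)"
  have s: "0 < s" "s * (2 * real n - 3) = 1" using two_le_n by (simp_all add: s_def)
  let ?u = "\<lambda>j. if j = c mod n then - s else s"
  let ?v = "\<lambda>i. if i = diagonal n c then 0 else s"
  have off: "total (\<lambda>i. if i = q then w else s) = w + (real n - 1) * s" if "q < n" for q w
    using that n_pos by (simp add: sum.remove[of _ q] of_nat_diff card_Diff_subset)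
  have "total ?u + total ?v = s * (2 * real n - 3)"
    using n_pos by (simp add: off diagonal_less algebra_simps)
  then have "point ?u ?v \<in> affine hull (Q_poly n idx)"
    using s by (auto simp: affine_hull_Q_poly)
  moreover have "point ?u ?v $ idx c < 0"
    using assms s by (simp add: point_nth)
  moreover have "0 \<le> point ?u ?v $ idx c'" if "c' < n\<^sup>2" "c' \<noteq> c" for c'
  proof -
    have "c' mod n \<noteq> c mod n \<or> diagonal n c' \<noteq> diagonal n c"
      using that assms bij_betw_column_diagonal[OF n_pos]
      unfolding bij_betw_def inj_on_def by blast
    then show ?thesis using that s by (auto simp: point_nth)
  qed
  ultimately show ?thesis using that by blast
qed

lemma irredundant_nonneg:
  "irredundant_system {0..n\<^sup>2 - 1} (\<lambda>i x. x $ idx i) (affine hull (Q_poly n idx)) (Q_poly n idx)"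
  unfolding irredundant_system_def
proof (intro conjI ballI)
  show "Q_poly n idx = {x \<in> affine hull (Q_poly n idx). \<forall>i\<in>{0..n\<^sup>2 - 1}. 0 \<le> x $ idx i}"
    by (rule Q_poly_eq_nonneg)
  fix c assume c: "c \<in> {0..n\<^sup>2 - 1}"
  have lt: "i \<in> {0..n\<^sup>2 - 1} \<Longrightarrow> i < n\<^sup>2" for i
    using n_pos by (simp add: Suc_le_eq[symmetric] le_diff_conv2)
  obtain x where x: "x \<in> affine hull (Q_poly n idx)" "x $ idx c < 0"
    "\<And>c'. c' < n\<^sup>2 \<Longrightarrow> c' \<noteq> c \<Longrightarrow> 0 \<le> x $ idx c'"
    using coordinate_irredundant[OF lt[OF c]] by blast
  have "x \<notin> Q_poly n idx"
  proof
    assume "x \<in> Q_poly n idx"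
    then have "\<forall>i\<in>{0..n\<^sup>2 - 1}. 0 \<le> x $ idx i"
      using Q_poly_eq_nonneg by blast
    then show False using x(2) c by (meson linorder_not_less)
  qed
  with x show "Q_poly n idx
      \<noteq> {x \<in> affine hull (Q_poly n idx). \<forall>i\<in>{0..n\<^sup>2 - 1} - {c}. 0 \<le> x $ idx i}"
    using lt by blast
qed

section \<open>Equations of the affine hull\<close>

lemma point_satisfies_equations:
  assumes "total u + total v = 1"
  shows "\<forall>l\<le>n - 1. 1 = (\<Sum>i = l * n..(l + 1) * n - 1. point u v $ idx i)"
    and "\<forall>j k. j + 2 \<le> n \<and> k + 3 \<le> n \<longrightarrow>
      0 = point u v $ idx (k * n + j mod n) - point u v $ idx ((k + 1) * n + j mod n)
        - point u v $ idx ((k + 1) * n + (j + 1) mod n)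
        + point u v $ idx ((k + 2) * n + (j + 1) mod n)"
proof -
  show "\<forall>l\<le>n - 1. 1 = (\<Sum>i = l * n..(l + 1) * n - 1. point u v $ idx i)"
  proof (intro allI impI)
    fix l assume "l \<le> n - 1"
    then have l: "l < n" using n_pos by simp
    then have "(\<Sum>j<n. point u v $ idx (l * n + j)) = total u + (\<Sum>j<n. v ((j + (n - l)) mod n))"
      by (simp add: point_cell sum.distrib)
    then show "1 = (\<Sum>i = l * n..(l + 1) * n - 1. point u v $ idx i)"
      using assms by (simp only: sum_block[OF n_pos] sum_mod_shift)
  qed
  show "\<forall>j k. j + 2 \<le> n \<and> k + 3 \<le> n \<longrightarrow>
      0 = point u v $ idx (k * n + j mod n) - point u v $ idx ((k + 1) * n + j mod n)
        - point u v $ idx ((k + 1) * n + (j + 1) mod n)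
        + point u v $ idx ((k + 2) * n + (j + 1) mod n)"
  proof (intro allI impI)
    fix j k assume jk: "j + 2 \<le> n \<and> k + 3 \<le> n"
    then have mods: "j mod n = j" "(j + 1) mod n = j + 1" by simp_all
    show "0 = point u v $ idx (k * n + j mod n) - point u v $ idx ((k + 1) * n + j mod n)
        - point u v $ idx ((k + 1) * n + (j + 1) mod n)
        + point u v $ idx ((k + 2) * n + (j + 1) mod n)"
      using jk unfolding mods
      by (subst point_cell, simp, simp)+ simp
  qed
qed

text \<open>The differences \<open>d\<close> of consecutive blocks are carried along the diagonals by the equations, so block \<open>k\<close>
  is the first block minus a stretch of \<open>k\<close> consecutive values of \<open>a = d 0\<close>. As \<open>a\<close> is
  periodic with sum \<open>0\<close> over a period, its partial sums \<open>V\<close> are periodic too and can serve as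
  weights of the diagonals.\<close>

lemma equations_imp_point:
  assumes blocks: "\<forall>l\<le>n - 1. 1 = (\<Sum>i = l * n..(l + 1) * n - 1. x $ idx i)"
    and corners: "\<forall>j k. j + 2 \<le> n \<and> k + 3 \<le> n \<longrightarrow>
      0 = x $ idx (k * n + j mod n) - x $ idx ((k + 1) * n + j mod n)
        - x $ idx ((k + 1) * n + (j + 1) mod n)
        + x $ idx ((k + 2) * n + (j + 1) mod n)"
  obtains u v where "x = point u v" "total u + total v = 1"
proof -
  define Y where "Y k j = x $ idx (k * n + j mod n)" for k j
  define d where "d k j = Y k j - Y (k + 1) j" for k j
  define a where "a = d 0"
  define V where "V m = (\<Sum>t\<le>m. a t)" for m
  have d_periodic: "d k (j + n) = d k j" for k j by (simp add: d_def Y_def)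
  have block: "(\<Sum>j<n. Y l j) = 1" if "l < n" for l
  proof -
    have "1 = (\<Sum>i = l * n..(l + 1) * n - 1. x $ idx i)" using blocks that by simp
    then show ?thesis unfolding sum_block[OF n_pos] by (simp add: Y_def)
  qed
  have d_sum: "(\<Sum>j<n. d k j) = 0" if "k + 1 < n" for k
    using that by (simp add: d_def sum_subtractf block)
  have d_step_inner: "d (k + 1) (j + 1) = d k j" if "k + 3 \<le> n" "j + 2 \<le> n" for k j
    using corners[rule_format, of j k] that by (simp add: d_def Y_def algebra_simps)
  \<comment> \<open>The step across the end of a block: all other steps are known, and both blocks of differences
    sum to \<open>0\<close>.\<close>
  have d_step_lt: "d (k + 1) (j + 1) = d k j" if k: "k + 3 \<le> n" and "j < n" for k j
  proof (cases "j + 2 \<le> n")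
    case False
    have n: "n = Suc (n - 1)" and j: "j = n - 1" using False \<open>j < n\<close> by simp_all
    have "(\<Sum>j<n. d (k + 1) (j + 1)) = (\<Sum>j<n. d (k + 1) ((j + 1) mod n))"
      by (simp add: d_def Y_def mod_Suc_eq)
    also have "\<dots> = (\<Sum>j<n. d (k + 1) j)" by (rule sum_mod_shift)
    also have "\<dots> = 0" using k by (intro d_sum) simp
    finally have "(\<Sum>j<n. d (k + 1) (j + 1)) = (\<Sum>j<n. d k j)" using k d_sum[of k] by simp
    then have "(\<Sum>j<n - 1. d (k + 1) (j + 1)) + d (k + 1) (n - 1 + 1)
        = (\<Sum>j<n - 1. d k j) + d k (n - 1)"
      by (subst (asm) (1 2) n) (simp only: sum.lessThan_Suc)
    moreover have "(\<Sum>j<n - 1. d (k + 1) (j + 1)) = (\<Sum>j<n - 1. d k j)"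
      using k by (intro sum.cong d_step_inner) auto
    ultimately show ?thesis unfolding j by simp
  qed (use d_step_inner k in blast)
  have d_mod: "d k (j mod n) = d k j" for k j by (simp add: d_def Y_def)
  have d_step: "d (k + 1) (j + 1) = d k j" if "k + 3 \<le> n" for k j
    using d_step_lt[OF that, of "j mod n"] n_pos d_mod[of k j] d_mod[of "k + 1" "j mod n + 1"]
      d_mod[of "k + 1" "j + 1"]
    by (simp add: mod_Suc_eq)
  have d_eq: "d k j = a (j + n - k)" if "k + 1 < n" for k j
    using that
  proof (induction k arbitrary: j)
    case 0
    then show ?case by (simp add: a_def d_periodic)
  next
    case (Suc k)
    have "d (k + 1) (j + n - 1 + 1) = d k (j + n - 1)"
      using Suc.prems by (intro d_step) simp
    then have "d (Suc k) j = d k (j + n - 1)" using n_pos by (simp add: d_periodic)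
    also have "\<dots> = a (j + n - 1 + n - k)" using Suc by simp
    also have "j + n - 1 + n - k = (j + n - Suc k) + n" using Suc.prems by simp
    finally show ?case by (simp add: a_def d_periodic)
  qed
  have a_sum: "(\<Sum>t<n. a t) = 0" using d_sum[of 0] two_le_n by (simp add: a_def)
  have V_periodic: "V (m + n) = V m" for m
  proof (induction m)
    case 0
    have "V n = (\<Sum>t<n. a t) + a n"
      by (simp add: V_def lessThan_Suc_atMost[symmetric])
    then show ?case using a_sum d_periodic[of 0 0] by (simp add: V_def a_def)
  next
    case (Suc m)
    then show ?case using d_periodic[of 0 "Suc m"] by (simp add: V_def a_def)
  qed
  have V_mod: "V (m mod n) = V m" for m
  proof -
    have "V (m mod n + q * n) = V (m mod n)" for q
      by (induction q) (simp_all add: V_periodic add.assoc[symmetric] add.commute[of n])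
    then show ?thesis by (metis mod_div_mult_eq)
  qed
  have Y_eq: "Y k j = Y 0 j - V j + V (j + n - k)" if "k < n" for k j
    using that
  proof (induction k)
    case 0
    then show ?case by (simp add: V_periodic)
  next
    case (Suc k)
    have "Y (Suc k) j = Y k j - d k j" by (simp add: d_def)
    also have "d k j = a (Suc (j + n - Suc k))"
      using Suc.prems by (simp add: d_eq Suc_diff_Suc)
    also have "\<dots> = V (Suc (j + n - Suc k)) - V (j + n - Suc k)" by (simp add: V_def)
    also have "Suc (j + n - Suc k) = j + n - k" using Suc.prems by simp
    finally show ?case using Suc by simp
  qed
  let ?u = "\<lambda>j. Y 0 j - V j"
  have "x = point ?u V"
  proof (rule vec_eq_on_grid)
    fix c assume c: "c < n\<^sup>2"
    then have "c div n < n" by (simp add: power2_eq_square less_mult_imp_div_less)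
    then have "Y (c div n) (c mod n) = ?u (c mod n) + V (diagonal n c)"
      by (simp add: Y_eq[of "c div n"] diagonal_def V_mod)
    then show "x $ idx c = point ?u V $ idx c"
      using c by (simp add: point_nth Y_def)
  qed
  moreover have "total ?u + total V = 1"
    using block[of 0] n_pos by (simp add: sum_subtractf)
  ultimately show ?thesis by (rule that)
qed

lemma affine_hull_Q_poly_equations:
  "affine hull (Q_poly n idx) =
    {x. (\<forall>l\<le>n - 1. 1 = (\<Sum>i = l * n..(l + 1) * n - 1. x $ idx i)) \<and>
        (\<forall>j k. j + 2 \<le> n \<and> k + 3 \<le> n \<longrightarrow>
           0 = x $ idx (k * n + j mod n) - x $ idx ((k + 1) * n + j mod n)
             - x $ idx ((k + 1) * n + (j + 1) mod n)
             + x $ idx ((k + 2) * n + (j + 1) mod n))}" (is "_ = ?E")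
proof
  show "affine hull (Q_poly n idx) \<subseteq> ?E"
    unfolding affine_hull_Q_poly using point_satisfies_equations by blast
  show "?E \<subseteq> affine hull (Q_poly n idx)"
  proof
    fix x assume "x \<in> ?E"
    then obtain u v where "x = point u v" "total u + total v = 1"
      using equations_imp_point by blast
    then show "x \<in> affine hull (Q_poly n idx)" unfolding affine_hull_Q_poly by blast
  qed
qed

end

section \<open>The free sum of two simplices\<close>

lemma free_sum_convex_hull:
  fixes A :: "'a::real_vector set" and B :: "'b::real_vector set"
  shows "free_sum (convex hull A) (convex hull B)
    = convex hull ((\<lambda>p. (p, 0)) ` A \<union> (\<lambda>p'. (0, p')) ` B)"
proof -
  have lin: "linear (\<lambda>p::'a. (p, 0::'b))" "linear (\<lambda>p'::'b. (0::'a, p'))"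
    by (auto intro!: linearI)
  show ?thesis
    unfolding free_sum_def convex_hull_linear_image[OF lin(1)] convex_hull_linear_image[OF lin(2)]
    by (rule hull_Un[symmetric]) (auto intro: convex_Inter)
qed

locale enumerated_grid_simplex = enumerated_grid n idx
  for n :: nat and idx :: "nat \<Rightarrow> 'm::finite" +
  fixes f :: "nat \<Rightarrow> 'd::finite"
  assumes f: "bij_betw f {..<n - 1} UNIV"
begin

text \<open>Identifies \<open>\<real>\<^sup>n\<^sup>-\<^sup>1\<close> with the hyperplane of weights with sum \<open>0\<close>: the last weight, with index
  \<open>n - 1\<close>, is determined by the others.\<close>

definition zero_sum_ext :: "real ^ 'd \<Rightarrow> nat \<Rightarrow> real" where
  "zero_sum_ext p j = (if j < n - 1 then p $ f j else - (\<Sum>a\<in>UNIV. p $ a))"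

lemma n_Suc: "n = Suc (n - 1)" using n_pos by simp

lemma card_d: "CARD('d) = n - 1"
  using bij_betw_same_card[OF f] by simp

lemma zero_sum_ext_add: "zero_sum_ext (p + q) = (\<lambda>j. zero_sum_ext p j + zero_sum_ext q j)"
  by (simp add: fun_eq_iff zero_sum_ext_def sum.distrib)

lemma zero_sum_ext_scale: "zero_sum_ext (t *\<^sub>R p) = (\<lambda>j. t * zero_sum_ext p j)"
  by (simp add: fun_eq_iff zero_sum_ext_def sum_distrib_left)

lemma zero_sum_ext_zero [simp]: "zero_sum_ext 0 j = 0"
  by (simp add: zero_sum_ext_def)

lemma total_zero_sum_ext: "total (zero_sum_ext p) = 0"
proof -
  have "total (zero_sum_ext p) = (\<Sum>j<n - 1. p $ f j) - (\<Sum>a\<in>UNIV. p $ a)"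
    by (subst n_Suc) (simp add: zero_sum_ext_def)
  then show ?thesis using sum.reindex_bij_betw[OF f, of "\<lambda>a. p $ a"] by simp
qed

lemma zero_sum_ext_surj:
  assumes "total w = 0"
  obtains p where "\<And>j. j < n \<Longrightarrow> zero_sum_ext p j = w j"
proof -
  define p where "p = (\<chi> a. w (inv_into {..<n - 1} f a))"
  have pf: "p $ f j = w j" if "j < n - 1" for j
    using that f by (simp add: p_def bij_betw_def inv_into_f_f)
  have "(\<Sum>a\<in>UNIV. p $ a) = (\<Sum>j<n - 1. w j)"
    by (simp add: sum.reindex_bij_betw[OF f, symmetric] pf)
  moreover have "(\<Sum>j<n - 1. w j) + w (n - 1) = 0"
    using assms by (subst (asm) n_Suc) simp
  ultimately have "zero_sum_ext p j = w j" if "j < n" for j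
    using that pf[of j] by (cases "j = n - 1") (auto simp: zero_sum_ext_def)
  then show ?thesis using that by blast
qed

definition lift :: "(real ^ 'd) \<times> (real ^ 'd) \<Rightarrow> real ^ 'm" where
  "lift z = point (zero_sum_ext (fst z)) (zero_sum_ext (snd z))"

lemma linear_lift: "linear lift"
  by (rule linearI) (simp_all add: lift_def point_add point_scale zero_sum_ext_add zero_sum_ext_scale)

text \<open>If all \<open>u j + v i\<close> vanish, then \<open>u\<close> and \<open>v\<close> are constant, and a constant with sum \<open>0\<close> is \<open>0\<close>.\<close>

lemma inj_lift: "inj lift"
proof -
  have "z = 0" if "lift z = 0" for z
  proof -
    have *: "zero_sum_ext (fst z) j + zero_sum_ext (snd z) i = 0" if ji: "j < n" "i < n" for i j
    proof -
      obtain c where "c < n\<^sup>2" "c mod n = j" "diagonal n c = i"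
        using column_diagonal_cell[OF ji] .
      then show ?thesis
        using \<open>lift z = 0\<close> point_nth[of c "zero_sum_ext (fst z)" "zero_sum_ext (snd z)"] by (simp add: lift_def)
    qed
    have snd0: "zero_sum_ext (snd z) i = 0" if "i < n" for i
    proof -
      have "(\<Sum>j<n. zero_sum_ext (fst z) j + zero_sum_ext (snd z) i) = 0"
        using * that by (intro sum.neutral) auto
      then show ?thesis using n_pos by (simp add: sum.distrib total_zero_sum_ext)
    qed
    have fst0: "zero_sum_ext (fst z) i = 0" if "i < n" for i
      using *[OF that n_pos] snd0[OF n_pos] by simp
    have "p = 0" if p: "\<And>i. i < n \<Longrightarrow> zero_sum_ext p i = 0" for p
    proof -
      have "p $ f i = 0" if "i < n - 1" for i
        using p[of i] that by (simp add: zero_sum_ext_def)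
      moreover have "\<exists>i<n - 1. a = f i" for a
        using f by (metis UNIV_I bij_betw_def imageE lessThan_iff)
      ultimately show ?thesis
        by (metis Finite_Cartesian_Product.vec_eq_iff zero_index)
    qed
    then show ?thesis using snd0 fst0 by (simp add: prod_eq_iff)
  qed
  then show ?thesis using linear_injective_0[OF linear_lift] by blast
qed

text \<open>The barycentre of the rows: moving half of the constant to the diagonals gives every row the weight
  \<open>1 / (2 * n)\<close>.\<close>

definition center :: "real ^ 'm" where
  "center = point (\<lambda>_. 1 / real n) (\<lambda>_. 0)"

text \<open>Subtracting their averages from \<open>u\<close> and from \<open>v\<close> makes both sums \<open>0\<close>; the two averages add up
  to \<open>1 / n\<close>, which is the value of all coordinates of the centre.\<close>

lemma affine_hull_eq_lift: "affine hull (Q_poly n idx) = (+) center ` range lift"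
proof
  show "affine hull (Q_poly n idx) \<subseteq> (+) center ` range lift"
  proof
    fix x assume "x \<in> affine hull (Q_poly n idx)"
    then obtain u v where uv: "x = point u v" "total u + total v = 1"
      by (auto simp: affine_hull_Q_poly)
    have "total (\<lambda>i. u i - total u / n) = 0" "total (\<lambda>i. v i - total v / n) = 0"
      using n_pos by (simp_all add: sum_subtractf)
    then obtain p q where pq: "\<And>j. j < n \<Longrightarrow> zero_sum_ext p j = u j - total u / n"
        "\<And>j. j < n \<Longrightarrow> zero_sum_ext q j = v j - total v / n"
      using zero_sum_ext_surj by metis
    have "1 / n = total u / n + total v / n"
      using uv by (simp add: add_divide_distrib[symmetric])
    then have "center + lift (p, q) = point (\<lambda>j. u j + total v / n) (\<lambda>j. v j - total v / n)"
      unfolding center_def lift_def point_add by (intro point_cong) (simp_all add: pq)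
    also have "\<dots> = x" by (simp add: point_shift uv)
    finally show "x \<in> (+) center ` range lift" by blast
  qed
  show "(+) center ` range lift \<subseteq> affine hull (Q_poly n idx)"
  proof clarify
    fix p q
    have "total (\<lambda>i. 1 / n + zero_sum_ext p i) + total (\<lambda>i. 0 + zero_sum_ext q i) = 1"
      using n_pos by (simp add: sum.distrib total_zero_sum_ext)
    then show "center + lift (p, q) \<in> affine hull (Q_poly n idx)"
      unfolding affine_hull_Q_poly center_def lift_def point_add by auto
  qed
qed

lemma aff_dim_Q_poly: "aff_dim (Q_poly n idx) = 2 * int n - 2"
proof -
  have "aff_dim (Q_poly n idx) = aff_dim (affine hull (Q_poly n idx))" by simp
  also have "\<dots> = aff_dim (range lift)"
    unfolding affine_hull_eq_lift by (rule aff_dim_translation_eq)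
  also have "\<dots> = int (DIM((real ^ 'd) \<times> (real ^ 'd)))"
    using linear_lift inj_lift by simp
  also have "\<dots> = 2 * int n - 2"
    using n_pos by (simp add: card_d of_nat_diff)
  finally show ?thesis .
qed

text \<open>The vertices \<open>e\<^sub>1, \<dots>, e\<^sub>n\<^sub>-\<^sub>1, 0\<close> of the standard simplex, moved by their barycentre: the last one is
  the one without an \<open>e\<close> part.\<close>

definition vertex :: "nat \<Rightarrow> real ^ 'd" where
  "vertex r = (\<chi> a. (if r < n - 1 \<and> a = f r then 1 else 0) - 1 / real n)"

definition centered_simplex :: "(real ^ 'd) set" where
  "centered_simplex = convex hull (vertex ` {..<n})"

text \<open>With the last coordinate restored, all vertices look alike: the standard basis of \<open>\<real>\<^sup>n\<close> projected to
  the hyperplane of sum \<open>0\<close>.\<close>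

lemma zero_sum_ext_vertex:
  assumes "r < n" "j < n"
  shows "zero_sum_ext (vertex r) j = (if j = r then 1 else 0) - 1 / n"
proof (cases "j < n - 1")
  case True
  then have "f j = f r \<longleftrightarrow> j = r" if "r < n - 1"
    using that f by (auto simp: bij_betw_def inj_on_def)
  then show ?thesis using True by (auto simp: zero_sum_ext_def vertex_def)
next
  case False
  then have j: "j = n - 1" using assms by simp
  have "(\<Sum>a\<in>UNIV. vertex r $ a) = (if r < n - 1 then 1 else 0) - (real n - 1) / n"
    using n_pos by (simp add: vertex_def sum_subtractf card_d of_nat_diff)
  then show ?thesis
    using j assms n_pos by (auto simp: zero_sum_ext_def diff_divide_distrib)
qed

lemma vertices_eq_translate:
  "vertex ` {..<n} = (+) (- (\<chi> a. 1 / real n)) ` insert 0 Basis"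
proof -
  have basis: "Basis = (\<lambda>r. axis (f r) (1::real)) ` {..<n - 1}"
  proof -
    have "Basis = range (\<lambda>a::'d. axis a (1::real))" by (auto simp: Basis_vec_def)
    also have "\<dots> = (\<lambda>a. axis a 1) ` f ` {..<n - 1}" using f by (simp add: bij_betw_def)
    finally show ?thesis by (simp add: image_image)
  qed
  have "vertex r = - (\<chi> a. 1 / real n) + axis (f r) 1" if "r < n - 1" for r
    using that by (simp add: vertex_def Finite_Cartesian_Product.vec_eq_iff axis_def)
  moreover have "vertex (n - 1) = - (\<chi> a. 1 / real n) + 0"
    by (simp add: vertex_def Finite_Cartesian_Product.vec_eq_iff)
  moreover have "{..<n} = insert (n - 1) {..<n - 1}" using n_pos by auto
  ultimately show ?thesis
    unfolding basis by (simp add: image_image)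
qed

lemma simplex_centered_simplex: "(int n - 1) simplex centered_simplex"
proof -
  have "\<not> affine_dependent (insert 0 Basis :: (real ^ 'd) set)"
    using affine_dependent_imp_dependent2 affine_dependent_iff_dependent[of 0 Basis]
      independent_Basis by (auto simp: affine_dependent_iff_dependent)
  then have "\<not> affine_dependent (vertex ` {..<n})"
    unfolding vertices_eq_translate using affine_dependent_translation_eq by blast
  moreover have "card (vertex ` {..<n}) = n"
    unfolding vertices_eq_translate using n_pos
    by (subst card_image) (auto simp: card_insert_if card_d)
  ultimately show ?thesis
    unfolding simplex_def centered_simplex_def by auto
qed

lemma zero_in_interior_centered_simplex: "0 \<in> interior centered_simplex"
proof -
  let ?g = "\<chi> a::'d. 1 / real n"
  have "?g \<in> interior (convex hull (insert 0 Basis))"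
  proof -
    have "(\<Sum>i\<in>Basis. ?g \<bullet> i) = (\<Sum>a\<in>(UNIV::'d set). 1 / real n)"
      unfolding Basis_vec_def
      by (subst sum.UNION_disjoint) (auto simp: axis_eq_axis inner_axis)
    also have "\<dots> < 1" using n_pos by (simp add: card_d of_nat_diff)
    finally show ?thesis
      using n_pos unfolding interior_std_simplex by (auto simp: Basis_vec_def inner_axis)
  qed
  then have "- ?g + ?g \<in> interior centered_simplex"
    unfolding centered_simplex_def vertices_eq_translate convex_hull_translation interior_translation
    by blast
  then show ?thesis by simp
qed

text \<open>The constant \<open>- 1 / n\<close> in the weights of a vertex cancels the centre, so that only the indicator of one
  column or one diagonal remains.\<close>

lemma lift_vertex:
  assumes "r < n"
  shows "center + lift (vertex r, 0) = row r" "center + lift (0, vertex r) = row (n + r)"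
proof -
  have "center + lift (vertex r, 0) = point (\<lambda>i. if i = r then 1 else 0) (\<lambda>_. 0)"
    unfolding center_def lift_def point_add using assms
    by (intro point_cong) (simp_all add: zero_sum_ext_vertex)
  then show "center + lift (vertex r, 0) = row r" using assms by (simp add: row_upper)
  have "center + lift (0, vertex r)
      = point (\<lambda>i. 0 + 1 / n) (\<lambda>i. (if i = r then 1 else 0) - 1 / n)"
    unfolding center_def lift_def point_add using assms
    by (intro point_cong) (simp_all add: zero_sum_ext_vertex)
  also have "\<dots> = point (\<lambda>_. 0) (\<lambda>i. if i = r then 1 else 0)"
    unfolding point_shift by simp
  finally show "center + lift (0, vertex r) = row (n + r)" using assms by (simp add: row_lower)
qed

lemma Q_poly_eq_lift_free_sum:
  "Q_poly n idx = (\<lambda>z. center + lift z) ` free_sum centered_simplex centered_simplex"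
proof -
  have "r \<in> {..<n} \<union> (+) n ` {..<n}" if "r < 2 * n" for r
    using that by (rule row_cases) auto
  then have rows: "{..<2 * n} = {..<n} \<union> (+) n ` {..<n}" by auto
  let ?S = "(\<lambda>p. (p, 0)) ` vertex ` {..<n} \<union> (\<lambda>p'. (0, p')) ` vertex ` {..<n}"
  have "row ` {..<2 * n} = (+) center ` lift ` ?S"
    unfolding rows image_Un image_image by (simp add: lift_vertex)
  then have "Q_poly n idx = convex hull ((+) center ` lift ` ?S)"
    by (simp add: Q_poly_eq_hull_rows)
  also have "\<dots> = (+) center ` lift ` (convex hull ?S)"
    by (simp only: convex_hull_translation convex_hull_linear_image[OF linear_lift])
  finally show ?thesis
    by (simp add: centered_simplex_def free_sum_convex_hull image_image)
qed

lemma Q_poly_affinely_isomorphic: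
  "affinely_isomorphic (Q_poly n idx) (free_sum centered_simplex centered_simplex)"
proof -
  obtain h where h: "linear h" "h \<circ> lift = id"
    using linear_injective_left_inverse[OF linear_lift inj_lift] by blast
  have "h (lift z) = z" for z
    using h(2) by (metis comp_apply id_apply)
  then have "h (center + lift z) + - h center = z" for z
    using h(1) by (simp add: linear_add)
  then have "bij_betw (\<lambda>x. h x + - h center) (Q_poly n idx)
      (free_sum centered_simplex centered_simplex)"
    unfolding Q_poly_eq_lift_free_sum
    by (intro bij_betwI[where g = "\<lambda>z. center + lift z"]) auto
  then show ?thesis using h(1) unfolding affinely_isomorphic_def by blast
qed

end

theorem theorem3p3:
  fixes n :: nat and idx :: "nat \<Rightarrow> 'm::finite"
  assumes "n \<ge> 2"
    and "bij_betw idx {..<n\<^sup>2} UNIV"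
    and "CARD('d::finite) = n - 1"
  shows "aff_dim (Q_poly n idx) = 2 * int n - 2 \<and>
    (\<exists>\<Delta> :: (real ^ 'd) set. (int n - 1) simplex \<Delta> \<and> 0 \<in> interior \<Delta> \<and>
       affinely_isomorphic (Q_poly n idx) (free_sum \<Delta> \<Delta>)) \<and>
    affine hull (Q_poly n idx) =
      {x. (\<forall>l\<le>n - 1. 1 = (\<Sum>i = l * n..(l + 1) * n - 1. x $ idx i)) \<and>
          (\<forall>j k. j + 2 \<le> n \<and> k + 3 \<le> n \<longrightarrow>
             0 = x $ idx (k * n + j mod n) - x $ idx ((k + 1) * n + j mod n)
               - x $ idx ((k + 1) * n + (j + 1) mod n)
               + x $ idx ((k + 2) * n + (j + 1) mod n))} \<and>
    irredundant_system {0..n\<^sup>2 - 1} (\<lambda>i x. x $ idx i)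
      (affine hull (Q_poly n idx)) (Q_poly n idx)"
proof -
  obtain f :: "nat \<Rightarrow> 'd" where "bij_betw f {..<n - 1} UNIV"
    using ex_bij_betw_nat_finite[of "UNIV :: 'd set"] assms(3) by (auto simp: lessThan_atLeast0)
  then interpret enumerated_grid_simplex n idx f
    using assms(1,2) by unfold_locales
  show ?thesis
    using aff_dim_Q_poly simplex_centered_simplex zero_in_interior_centered_simplex
      Q_poly_affinely_isomorphic affine_hull_Q_poly_equations irredundant_nonneg
    by blast
qed

end
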